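(* Let $t,m,s,v$ be positive integers with $t\geq 2$ and $s\leq t\leq ms$. Then $$OCAN(t,m,s,v)\leq \left\lfloor \frac{OCAN(t+1,m+1,s,v)}{v} \right\rfloor.$$
   Context: NRT poset: for positive integers $m,s$, the NRT poset $[m\cdot s]$ is the set $\{1,\ldots,ms\}$ partitioned into $m$ blocks $B_i=\{is+1,\ldots,(i+1)s\}$, $i=0,\ldots,m-1$, where each block is a chain $is+1\preceq is+2\preceq\cdots\preceq (i+1)s$ and elements of different blocks are incomparable. An ideal is a subset $I$ such that $b\in I$ and $a\preceq b$ imply $a\in I$; an anti-ideal is the complement of an ideal. Covering: given an $N\times n$ array over an alphabet $V$ of size $v$, a set of $t$ columns is covered if every $t$-tuple over $V$ occurs at least once as a row of the $N\times t$ subarray formed by those columns. Ordered covering array: for $2\le t\le ms$, an $OCA(N;t,m,s,v)$ is an $N\times ms$ array with entries from an alphabet of size $v$, with columns labeled by $[m\cdot s]$, such that for every anti-ideal $J$ of $[m\cdot s]$ with $|J|=t$ the set of columns labeled by $J$ is covered. $OCAN(t,m,s,v)$ is the smallest positive integer $N$ such that an $OCA(N;t,m,s,v)$ exists. *)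

theory Defs
  imports Complex_Main "HOL-Library.FuncSet"
begin

definition nrt_block :: "nat \<Rightarrow> nat \<Rightarrow> nat set" where
  "nrt_block s i = {i * s + 1..(i + 1) * s}"

definition nrt_set :: "nat \<Rightarrow> nat \<Rightarrow> nat set" where
  "nrt_set m s = {1..m * s}"

definition nrt_rel :: "nat \<Rightarrow> nat \<Rightarrow> nat rel" where
  "nrt_rel m s = {(a, b). \<exists>i<m. a \<in> nrt_block s i \<and> b \<in> nrt_block s i \<and> a \<le> b}"

definition is_ideal :: "'a set \<Rightarrow> 'a rel \<Rightarrow> 'a set \<Rightarrow> bool" where
  "is_ideal P r I \<longleftrightarrow> I \<subseteq> P \<and> (\<forall>b\<in>I. \<forall>a\<in>P. (a, b) \<in> r \<longrightarrow> a \<in> I)"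

definition is_anti_ideal :: "'a set \<Rightarrow> 'a rel \<Rightarrow> 'a set \<Rightarrow> bool" where
  "is_anti_ideal P r J \<longleftrightarrow> (\<exists>I. is_ideal P r I \<and> J = P - I)"

text \<open>An array with \<open>N\<close> rows is a function \<open>A\<close> taking a row index in \<open>{..<N}\<close> and a column label
  to an entry; values outside the index ranges are irrelevant. A tuple over \<open>V\<close> indexed by the
  columns in \<open>J\<close> is an element of \<open>J \<rightarrow>\<^sub>E V\<close>.\<close>

definition covered :: "nat \<Rightarrow> 'a set \<Rightarrow> (nat \<Rightarrow> 'c \<Rightarrow> 'a) \<Rightarrow> 'c set \<Rightarrow> bool" where
  "covered N V A J \<longleftrightarrow> (\<forall>x \<in> J \<rightarrow>\<^sub>E V. \<exists>r<N. \<forall>j\<in>J. A r j = x j)"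

definition is_OCA ::
  "'a set \<Rightarrow> (nat \<Rightarrow> nat \<Rightarrow> 'a) \<Rightarrow> nat \<Rightarrow> nat \<Rightarrow> nat \<Rightarrow> nat \<Rightarrow> nat \<Rightarrow> bool" where
  "is_OCA V A N t m s v \<longleftrightarrow>
     2 \<le> t \<and> t \<le> m * s \<and> finite V \<and> card V = v \<and>
     (\<forall>r<N. \<forall>j\<in>nrt_set m s. A r j \<in> V) \<and>
     (\<forall>J. is_anti_ideal (nrt_set m s) (nrt_rel m s) J \<and> card J = t \<longrightarrow> covered N V A J)"

text \<open>Only the cardinality of the alphabet matters, so taking it to be a set of natural numbers
  loses no generality.\<close>

definition OCAN :: "nat \<Rightarrow> nat \<Rightarrow> nat \<Rightarrow> nat \<Rightarrow> nat" where
  "OCAN t m s v =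
     (LEAST N. 0 < N \<and> (\<exists>(V :: nat set) A. is_OCA V A N t m s v))"

end

theory Submission
  imports Defs
begin

text \<open>Adding the maximum \<open>c\<close> of the last block to an anti-ideal of \<open>[m \<cdot> s]\<close> gives an anti-ideal
  of \<open>[(m + 1) \<cdot> s]\<close>. Hence, in an ordered covering array of strength \<open>t + 1\<close> on \<open>[(m + 1) \<cdot> s]\<close>,
  the rows with a prescribed symbol in column \<open>c\<close> form one of strength \<open>t\<close> on \<open>[m \<cdot> s]\<close>, and
  some symbol occurs in column \<open>c\<close> in at most the fraction \<open>1 / v\<close> of the rows.\<close>

lemma is_anti_ideal_iff_upclosed:
  "is_anti_ideal P r J \<longleftrightarrow> J \<subseteq> P \<and> (\<forall>a\<in>J. \<forall>b\<in>P. (a, b) \<in> r \<longrightarrow> b \<in> J)"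
  (is "?L \<longleftrightarrow> ?R")
proof
  assume ?L
  then show ?R by (auto simp: is_anti_ideal_def is_ideal_def)
next
  assume ?R
  then have "is_ideal P r (P - J)" and "J = P - (P - J)"
    by (auto simp: is_ideal_def)
  then show ?L unfolding is_anti_ideal_def by blast
qed

text \<open>Supplies an anti-ideal of each size \<open>k\<close> up to \<open>m * s\<close>, so that
  the covering condition of an array is never vacuous.\<close>

lemma is_anti_ideal_nrt_final_segment:
  "is_anti_ideal (nrt_set m s) (nrt_rel m s) {m * s - k<..m * s}"
  by (auto simp: is_anti_ideal_iff_upclosed nrt_set_def nrt_rel_def)

text \<open>The order on the first \<open>m\<close> blocks is unchanged by the new block, so what
  lies above an element of \<open>J\<close> is still in \<open>J\<close>; above the added label lies
  only that label itself.\<close>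

lemma is_anti_ideal_nrt_insert_max:
  assumes "0 < s" and J: "is_anti_ideal (nrt_set m s) (nrt_rel m s) J"
  shows "is_anti_ideal (nrt_set (m + 1) s) (nrt_rel (m + 1) s) (insert ((m + 1) * s) J)"
  unfolding is_anti_ideal_iff_upclosed
proof (intro conjI ballI impI)
  have sub: "J \<subseteq> {1..m * s}"
    using J by (auto simp: is_anti_ideal_iff_upclosed nrt_set_def)
  then show "insert ((m + 1) * s) J \<subseteq> nrt_set (m + 1) s"
    using \<open>0 < s\<close> by (auto simp: nrt_set_def)
  fix a b
  assume a: "a \<in> insert ((m + 1) * s) J" and b: "b \<in> nrt_set (m + 1) s"
    and ab: "(a, b) \<in> nrt_rel (m + 1) s"
  from ab obtain i where i: "i < m + 1" "a \<in> nrt_block s i" "b \<in> nrt_block s i" "a \<le> b"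
    by (auto simp: nrt_rel_def)
  show "b \<in> insert ((m + 1) * s) J"
  proof (cases "a \<in> J")
    case True
    then have "a \<le> m * s" using sub by auto
    \<comment> \<open>Blocks start at \<open>i * s + 1\<close>, which makes this strict and excludes
      the new block \<open>i = m\<close>.\<close>
    with i(2) have "i * s < m * s" unfolding nrt_block_def atLeastAtMost_iff by linarith
    then have "i < m" by simp
    then have "(i + 1) * s \<le> m * s" by (intro mult_le_mono1) simp
    with i(3) have "b \<in> nrt_set m s" by (simp add: nrt_set_def nrt_block_def)
    moreover have "(a, b) \<in> nrt_rel m s" using \<open>i < m\<close> i by (auto simp: nrt_rel_def)
    ultimately show ?thesis using J True by (auto simp: is_anti_ideal_iff_upclosed)
  next
    case False
    \<comment> \<open>Here \<open>a\<close> is the largest label of all, which forces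
      \<open>b = a\<close>.\<close>
    with a b \<open>a \<le> b\<close> show ?thesis by (auto simp: nrt_set_def)
  qed
qed

text \<open>Arrays number their rows by an initial segment of the naturals, whereas the
  constructions below yield rows indexed by an arbitrary finite set.\<close>

lemma finite_rows_reindex:
  fixes R :: "'r set" and B :: "'r \<Rightarrow> 'c \<Rightarrow> 'a"
  assumes "finite R"
  shows "\<exists>A. (\<forall>r<card R. \<exists>q\<in>R. A r = B q) \<and> (\<forall>q\<in>R. \<exists>r<card R. A r = B q)"
proof -
  obtain h where h: "bij_betw h {0..<card R} R"
    using ex_bij_betw_nat_finite[OF assms] by blast
  have "\<exists>q\<in>R. B (h r) = B q" if "r < card R" for r
    using h that by (auto simp: bij_betw_def)
  moreover have "\<exists>r<card R. B (h r) = B q" if "q \<in> R" for q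
    using bij_betw_imp_surj_on[OF h] that by (metis atLeastLessThan_iff imageE)
  ultimately show ?thesis by (intro exI[of _ "\<lambda>r. B (h r)"]) blast
qed

text \<open>Some tuple has to be covered, and this takes a row. Hence the condition
  \<open>0 < N\<close> in \<open>OCAN\<close> holds automatically for a nonempty alphabet.\<close>

lemma is_OCA_rows_pos:
  assumes "is_OCA V A N t m s v" and "0 < v"
  shows "0 < N"
proof -
  let ?J = "{m * s - t<..m * s}"
  have "card ?J = t" using assms by (simp add: is_OCA_def)
  with is_anti_ideal_nrt_final_segment have "covered N V A ?J"
    using assms by (simp add: is_OCA_def)
  moreover obtain a where "a \<in> V" using assms by (fastforce simp: is_OCA_def)
  then have "(\<lambda>j\<in>?J. a) \<in> ?J \<rightarrow>\<^sub>E V" by simp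
  ultimately obtain r where "r < N" unfolding covered_def by blast
  then show ?thesis by simp
qed

text \<open>The array whose rows are all tuples over \<open>V\<close> on the full label set covers
  every set of columns.\<close>

lemma ex_is_OCA:
  assumes "finite V" and "V \<noteq> {}" and "2 \<le> t" and "t \<le> m * s"
  shows "\<exists>A N. is_OCA V A N t m s (card V)"
proof -
  let ?P = "nrt_set m s"
  have fin: "finite (?P \<rightarrow>\<^sub>E V)"
    using \<open>finite V\<close> by (intro finite_PiE) (auto simp: nrt_set_def)
  obtain a where a: "a \<in> V" using \<open>V \<noteq> {}\<close> by blast
  obtain A where A1: "\<forall>r<card (?P \<rightarrow>\<^sub>E V). \<exists>q\<in>?P \<rightarrow>\<^sub>E V. A r = id q"
    and A2: "\<forall>q\<in>?P \<rightarrow>\<^sub>E V. \<exists>r<card (?P \<rightarrow>\<^sub>E V). A r = id q"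
    using finite_rows_reindex[OF fin, of id] by auto
  have "covered (card (?P \<rightarrow>\<^sub>E V)) V A J" if "J \<subseteq> ?P" for J
    unfolding covered_def
  proof
    fix x assume x: "x \<in> J \<rightarrow>\<^sub>E V"
    \<comment> \<open>The value \<open>a\<close> is an arbitrary filler for the columns outside
      \<open>J\<close>.\<close>
    let ?q = "\<lambda>j\<in>?P. if j \<in> J then x j else a"
    have "?q \<in> ?P \<rightarrow>\<^sub>E V" using x a by (auto simp: PiE_iff)
    then obtain r where r: "r < card (?P \<rightarrow>\<^sub>E V)" "A r = ?q" using A2 by (metis id_apply)
    then have "\<forall>j\<in>J. A r j = x j" using that by auto
    with r show "\<exists>r<card (?P \<rightarrow>\<^sub>E V). \<forall>j\<in>J. A r j = x j" by blast
  qed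
  moreover have "A r j \<in> V" if "r < card (?P \<rightarrow>\<^sub>E V)" and "j \<in> ?P" for r j
    using A1 that by fastforce
  ultimately have "is_OCA V A (card (?P \<rightarrow>\<^sub>E V)) t m s (card V)"
    using assms by (simp add: is_OCA_def is_anti_ideal_iff_upclosed)
  then show ?thesis by blast
qed

lemma OCAN_le:
  fixes V :: "nat set"
  assumes "is_OCA V A N t m s v" and "0 < v"
  shows "OCAN t m s v \<le> N"
  unfolding OCAN_def using assms is_OCA_rows_pos[OF assms] by (blast intro: Least_le)

text \<open>The minimum is attained, since the full array over \<open>{..<v}\<close> shows that
  \<open>LEAST\<close> ranges over a nonempty set.\<close>

lemma is_OCA_OCAN:
  assumes "0 < v" and "2 \<le> t" and "t \<le> m * s"
  obtains V :: "nat set" and A where "is_OCA V A (OCAN t m s v) t m s v"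
proof -
  obtain A N where A: "is_OCA {..<v} A N t m s v"
    using ex_is_OCA[of "{..<v}" t m s] assms by (auto simp: lessThan_empty_iff)
  have "\<exists>N. 0 < N \<and> (\<exists>(V :: nat set) A. is_OCA V A N t m s v)"
    using A is_OCA_rows_pos[OF A \<open>0 < v\<close>] by blast
  from LeastI_ex[OF this] show thesis
    using that unfolding OCAN_def by blast
qed

text \<open>Averaging: the fibres of \<open>f\<close> partition \<open>R\<close>, so they cannot all
  be larger than \<open>card R / card V\<close>.\<close>

lemma ex_rare_value:
  fixes f :: "'r \<Rightarrow> 'a"
  assumes "finite R" and "finite V" and "V \<noteq> {}" and "\<And>r. r \<in> R \<Longrightarrow> f r \<in> V"
  shows "\<exists>a\<in>V. card V * card {r \<in> R. f r = a} \<le> card R"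
proof (rule ccontr)
  assume "\<not> ?thesis"
  then have "(\<Sum>a\<in>V. card R) < (\<Sum>a\<in>V. card V * card {r \<in> R. f r = a})"
    using assms by (intro sum_strict_mono) (auto simp: not_le)
  also have "\<dots> = card V * (\<Sum>a\<in>V. card {r \<in> R. f r = a})"
    by (simp add: sum_distrib_left)
  also have "(\<Sum>a\<in>V. card {r \<in> R. f r = a}) = card (\<Union>a\<in>V. {r \<in> R. f r = a})"
    using assms by (intro card_UN_disjoint[symmetric]) auto
  also have "(\<Union>a\<in>V. {r \<in> R. f r = a}) = R" using assms(4) by auto
  finally show False by simp
qed

text \<open>Extend a tuple on \<open>J\<close> by the symbol \<open>a\<close> in the last column. A
  row of \<open>A\<close> realising the extension has \<open>a\<close> there, so it is among the
  selected rows.\<close>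

lemma is_OCA_derive:
  assumes oca: "is_OCA V A N (t + 1) (m + 1) s v"
    and "0 < s" and "2 \<le> t" and "t \<le> m * s" and "a \<in> V"
  shows "\<exists>B. is_OCA V B (card {r. r < N \<and> A r ((m + 1) * s) = a}) t m s v"
proof -
  let ?c = "(m + 1) * s" and ?R = "{r. r < N \<and> A r ((m + 1) * s) = a}"
  have fin: "finite ?R" by simp
  obtain B where B1: "\<forall>r<card ?R. \<exists>q\<in>?R. B r = A q"
    and B2: "\<forall>q\<in>?R. \<exists>r<card ?R. B r = A q"
    using finite_rows_reindex[OF fin, of A] by auto
  have "covered (card ?R) V B J"
    if J: "is_anti_ideal (nrt_set m s) (nrt_rel m s) J" and "card J = t" for J
    unfolding covered_def
  proof
    fix x assume x: "x \<in> J \<rightarrow>\<^sub>E V"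
    have sub: "J \<subseteq> {1..m * s}"
      using J by (auto simp: is_anti_ideal_iff_upclosed nrt_set_def)
    then have "finite J" by (rule finite_subset) simp
    moreover have "?c \<notin> J" using sub \<open>0 < s\<close> by auto
    ultimately have "card (insert ?c J) = t + 1" using \<open>card J = t\<close> by simp
    then have "covered N V A (insert ?c J)"
      using oca is_anti_ideal_nrt_insert_max[OF \<open>0 < s\<close> J] unfolding is_OCA_def by blast
    moreover have "x(?c := a) \<in> insert ?c J \<rightarrow>\<^sub>E V"
      using x \<open>a \<in> V\<close> by (rule PiE_fun_upd[rotated])
    ultimately obtain q where q: "q < N" "\<forall>j\<in>insert ?c J. A q j = (x(?c := a)) j"
      unfolding covered_def by blast
    then have "q \<in> ?R" by simp
    with B2 obtain r where "r < card ?R" "B r = A q" by blast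
    moreover have "\<forall>j\<in>J. A q j = x j" using q(2) \<open>?c \<notin> J\<close> by (metis fun_upd_apply insertCI)
    ultimately show "\<exists>r<card ?R. \<forall>j\<in>J. B r j = x j" by auto
  qed
  moreover have "B r j \<in> V" if r: "r < card ?R" and j: "j \<in> nrt_set m s" for r j
  proof -
    obtain q where "q < N" "B r = A q" using B1 r by blast
    moreover have "j \<in> nrt_set (m + 1) s" using j by (auto simp: nrt_set_def)
    ultimately show ?thesis using oca by (simp add: is_OCA_def)
  qed
  ultimately have "is_OCA V B (card ?R) t m s v"
    using assms by (simp add: is_OCA_def)
  then show ?thesis by blast
qed

theorem proposition5:
  fixes t m s v :: nat
  assumes "0 < m" and "0 < s" and "0 < v"
    and "2 \<le> t" and "s \<le> t" and "t \<le> m * s"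
  shows "int (OCAN t m s v) \<le> \<lfloor>real (OCAN (t + 1) (m + 1) s v) / real v\<rfloor>"
proof -
  let ?N = "OCAN (t + 1) (m + 1) s v" and ?c = "(m + 1) * s"
  \<comment> \<open>The second bound holds because the new block contributes \<open>s\<close>, hence
    at least one, further label.\<close>
  have "2 \<le> t + 1" and "t + 1 \<le> (m + 1) * s" using assms by auto
  with \<open>0 < v\<close> obtain V :: "nat set" and A where oca: "is_OCA V A ?N (t + 1) (m + 1) s v"
    by (rule is_OCA_OCAN)
  then have V: "finite V" "card V = v" "V \<noteq> {}" using \<open>0 < v\<close> by (auto simp: is_OCA_def)
  have "?c \<in> nrt_set (m + 1) s" using \<open>0 < s\<close> by (simp add: nrt_set_def)
  then have "\<forall>r<?N. A r ?c \<in> V" using oca by (simp add: is_OCA_def)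
  \<comment> \<open>The rarest symbol of the last column; the bound stays in product form until the
    final passage to the floor.\<close>
  then obtain a where a: "a \<in> V" "v * card {r. r < ?N \<and> A r ?c = a} \<le> ?N"
    using ex_rare_value[of "{..<?N}" V "\<lambda>r. A r ?c"] V by auto
  obtain B where "is_OCA V B (card {r. r < ?N \<and> A r ?c = a}) t m s v"
    using is_OCA_derive[OF oca \<open>0 < s\<close> \<open>2 \<le> t\<close> \<open>t \<le> m * s\<close> a(1)] by blast
  then have "OCAN t m s v \<le> card {r. r < ?N \<and> A r ?c = a}" using \<open>0 < v\<close> by (rule OCAN_le)
  then have "v * OCAN t m s v \<le> ?N" using a(2) by (meson le_trans mult_le_mono2)
  then have "real (OCAN t m s v) * real v \<le> real ?N"
    by (metis mult.commute of_nat_le_iff of_nat_mult)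
  then show ?thesis using \<open>0 < v\<close> by (simp add: le_floor_iff pos_le_divide_eq)
qed

end
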